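(* Let $N\ge 3$, let $A^{(N)}$ be a generator in a stable sandpile $\eta \in \Omega$ that has the form of an $N \times N$ square, let $k\in\{2, \ldots, \lceil N/2 \rceil\}$, and let $v_i \in C\big(\bigcup_{j=1}^k R_j(A^{(N)}) \big)$. Then $$\mathbb{E}[X(\gamma_i \eta)\mid Y \in A^{(N)}] = \begin{cases} \dfrac{3N^5 + 15N^4 + 15N^3-15N^2 - 18N+10(4k^3 - 24k^2+23k-3)}{30N^2}, &\text{if } N \text{ is odd,} \\[1.2em] \dfrac{3N^5 + 15N^4 + 15N^3 - 15N^2 - 18N + 10(4k^3 - 18k^2 + 2k + 3)}{30N^2}, &\text{if } N \text{ is even.} \end{cases}$$
   Context: Fix an integer $L\ge 1$ and let $V=\{1,\ldots,L\}^2\subset\mathbb{Z}^2$, labelled $V=\{v_1,\ldots,v_{L^2}\}$. For $v,w\in V$ write $v\sim w$ if $v,w$ are nearest neighbours in $\mathbb{Z}^2$; connectedness of subsets of $V$ refers to this relation. All vertices of $\mathbb{Z}^2\setminus V$ are identified with a single sink; every $v\in V$ has four edges to its lattice neighbours, those leading outside $V$ going to the sink (grains sent there are discarded). A sandpile is a map $\eta:V\to\mathbb{Z}$. $\Omega$ is the set of stable sandpiles, i.e. those with $0\le\eta(v)<4$ for all $v\in V$. A vertex $v$ is critical in $\eta$ if $\eta(v)=3$. A generator in $\eta$ is a connected component (maximal connected set) of the set of critical vertices of $\eta$. The removal operator $\gamma_i$ sets $\eta(v_i)$ to $0$ and leaves all other values unchanged. Toppling a vertex $v\in V$ decreases $\eta(v)$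 by $4$ and increases $\eta(w)$ by $1$ for each $w\in V$ with $w\sim v$; the toppling is legal if $\eta(v)>3$. Avalanche size: for $\eta\in\Omega$ and $v\in V$, $x(\eta,v)$ is the total number of topplings (counted with multiplicity) in any sequence of legal topplings that starts at the configuration obtained from $\eta$ by adding one grain at $v$ and ends at a stable configuration; this number is finite and independent of the sequence. $Y$ is uniformly distributed on $V$ (the vertex where the next grain lands) and $X(\eta)=x(\eta,Y)$, so for nonempty $B\subseteq V$, $\mathbb{E}[X(\eta)\mid Y\in B]=\frac{1}{|B|}\sum_{v\in B}x(\eta,v)$. Rings: for a square $B$ of side at least $3$, let $\delta^{\mathrm{in}}(B)$ (resp. $C(B)$) be the set of $v\in B$ having exactly one (resp. exactly two) nearest neighbours in $\mathbb{Z}^2$ outside $B$ (so $C(B)$ is the set of the four corners). For an $N\times N$ square $A$ with $N\ge3$ and $m=\lceil N/2\rceil$: $R_m(A)=\delta^{\mathrm{in}}(A)\cup C(A)$; for $j=m-1,\ldots,2$, $R_j(A)=\delta^{\mathrm{in}}(A_j)\cup C(A_j)$ with $A_j=A\setminus\bigcup_{k=j+1}^{m}R_k(A)$; and $R_1(A)=A\setminus\bigcup_{k=2}^{m}R_k(A)$. Thus $\bigcup_{j=1}^k R_j(A)$ is a concentric sub-square of $A$ with outermost layer $R_k(A)$. *)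

theory Defs
  imports "HOL-Probability.Probability"
begin

type_synonym vertex = "int \<times> int"

text \<open>A sandpile on the grid \<open>{1..L}\<times>{1..L}\<close> is a total function on \<open>\<int>\<^sup>2\<close>; its values outside the
  grid are unconstrained and irrelevant.\<close>

type_synonym sandpile = "vertex \<Rightarrow> int"

definition grid :: "nat \<Rightarrow> vertex set" where
  "grid L = {1..int L} \<times> {1..int L}"

definition nbr :: "vertex \<Rightarrow> vertex \<Rightarrow> bool" where
  "nbr v w \<longleftrightarrow> \<bar>fst v - fst w\<bar> + \<bar>snd v - snd w\<bar> = 1"

definition stable_sandpiles :: "nat \<Rightarrow> sandpile set" where
  "stable_sandpiles L = {\<eta>. \<forall>v\<in>grid L. 0 \<le> \<eta> v \<and> \<eta> v < 4}"

definition critical :: "nat \<Rightarrow> sandpile \<Rightarrow> vertex set" where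
  "critical L \<eta> = {v \<in> grid L. \<eta> v = 3}"

definition lattice_connected :: "vertex set \<Rightarrow> bool" where
  "lattice_connected S \<longleftrightarrow> (\<forall>v\<in>S. \<forall>w\<in>S. (v, w) \<in> {(a, b). a \<in> S \<and> b \<in> S \<and> nbr a b}\<^sup>*)"

definition generator :: "nat \<Rightarrow> sandpile \<Rightarrow> vertex set \<Rightarrow> bool" where
  "generator L \<eta> A \<longleftrightarrow> A \<noteq> {} \<and> A \<subseteq> critical L \<eta> \<and> lattice_connected A \<and>
     (\<forall>B. A \<subseteq> B \<and> B \<subseteq> critical L \<eta> \<and> lattice_connected B \<longrightarrow> B = A)"

definition removal :: "vertex \<Rightarrow> sandpile \<Rightarrow> sandpile" where
  "removal v \<eta> = \<eta>(v := 0)"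

definition add_grain :: "vertex \<Rightarrow> sandpile \<Rightarrow> sandpile" where
  "add_grain v \<eta> = \<eta>(v := \<eta> v + 1)"

definition topple :: "nat \<Rightarrow> vertex \<Rightarrow> sandpile \<Rightarrow> sandpile" where
  "topple L v \<eta> = (\<lambda>w. if w = v then \<eta> w - 4
                       else if w \<in> grid L \<and> nbr w v then \<eta> w + 1 else \<eta> w)"

text \<open>\<open>legal_topplings L \<eta> n \<xi>\<close>: some sequence of \<open>n\<close> legal topplings leads from \<open>\<eta>\<close> to \<open>\<xi>\<close>.\<close>

inductive legal_topplings :: "nat \<Rightarrow> sandpile \<Rightarrow> nat \<Rightarrow> sandpile \<Rightarrow> bool" for L :: nat where
  none: "legal_topplings L \<eta> 0 \<eta>"
| step: "v \<in> grid L \<Longrightarrow> \<eta> v > 3 \<Longrightarrow> legal_topplings L (topple L v \<eta>) n \<xi> \<Longrightarrow>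
         legal_topplings L \<eta> (Suc n) \<xi>"

text \<open>The definite description is legitimate for stable \<open>\<eta>\<close> and \<open>v\<close> in the grid: a stabilizing
  sequence of legal topplings exists and, by the abelian property, all of them have the same length.\<close>

definition avalanche_size :: "nat \<Rightarrow> sandpile \<Rightarrow> vertex \<Rightarrow> nat" where
  "avalanche_size L \<eta> v =
     (THE n. \<exists>\<xi> \<in> stable_sandpiles L. legal_topplings L (add_grain v \<eta>) n \<xi>)"

text \<open>\<open>E[X(\<eta>) | Y \<in> B]\<close> for \<open>Y\<close> uniform on the grid and \<open>X(\<eta>) = avalanche_size L \<eta> Y\<close>.\<close>

definition cond_avalanche :: "nat \<Rightarrow> sandpile \<Rightarrow> vertex set \<Rightarrow> real" where
  "cond_avalanche L \<eta> B =
     measure_pmf.expectation (cond_pmf (pmf_of_set (grid L)) B)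
       (\<lambda>y. real (avalanche_size L \<eta> y))"

lemma cond_avalanche_eq_average:
  assumes "B \<subseteq> grid L" and "B \<noteq> {}"
  shows "cond_avalanche L \<eta> B = (\<Sum>v\<in>B. real (avalanche_size L \<eta> v)) / real (card B)"
proof -
  have fin: "finite (grid L)" by (simp add: grid_def)
  have fB: "finite B" using finite_subset[OF assms(1) fin] .
  have ne: "grid L \<noteq> {}" "grid L \<inter> B \<noteq> {}" and eq: "grid L \<inter> B = B" using assms by auto
  have "cond_pmf (pmf_of_set (grid L)) B = pmf_of_set B"
  proof (rule pmf_eqI)
    fix y
    have inter: "set_pmf (pmf_of_set (grid L)) \<inter> B \<noteq> {}"
      using ne fin by simp
    show "pmf (cond_pmf (pmf_of_set (grid L)) B) y = pmf (pmf_of_set B) y"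
      using pmf_cond[OF inter, of y] measure_pmf_of_set[OF ne(1) fin, of B]
      by (cases "y \<in> B") (use assms fin fB ne eq in \<open>auto simp: indicator_def\<close>)
  qed
  then show ?thesis
    unfolding cond_avalanche_def using integral_pmf_of_set[OF assms(2) fB] by simp
qed

definition is_square :: "nat \<Rightarrow> vertex set \<Rightarrow> bool" where
  "is_square N A \<longleftrightarrow> (\<exists>a b. A = {a..<a + int N} \<times> {b..<b + int N})"

definition inner_boundary :: "vertex set \<Rightarrow> vertex set" where
  "inner_boundary B = {v \<in> B. card {w. nbr v w \<and> w \<notin> B} = 1}"

definition corners :: "vertex set \<Rightarrow> vertex set" where
  "corners B = {v \<in> B. card {w. nbr v w \<and> w \<notin> B} = 2}"

definition num_rings :: "nat \<Rightarrow> nat" where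
  "num_rings N = nat \<lceil>real N / 2\<rceil>"

text \<open>The ring \<open>R\<^sub>j\<close> of an \<open>N \<times> N\<close> square \<open>A\<close>, for \<open>1 \<le> j \<le> num_rings N\<close>. The recursion runs
  downwards from \<open>j = num_rings N\<close> (the outermost ring, where the union is empty).\<close>

function ring_layer :: "nat \<Rightarrow> vertex set \<Rightarrow> nat \<Rightarrow> vertex set" where
  "ring_layer N A j =
     (let B = A - (\<Union>k\<in>{j + 1..num_rings N}. ring_layer N A k)
      in if j = 1 then B else inner_boundary B \<union> corners B)"
  by pat_completeness auto
termination
  by (relation "Wellfounded.measure (\<lambda>(N, A, j). num_rings N - j)") auto

declare ring_layer.simps [simp del]

end

theory Submission
  imports Defs
begin

text \<open>
  An avalanche is determined by its toppling function: how often each vertex topples. By the least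
  action principle this is the pointwise least nonnegative function \<open>z\<close>, zero off the grid, whose
  topplings leave every vertex with at most three grains
  (\<open>avalanche_size_eq_least_stabiliser\<close>). So instead of following topplings in time, it is enough to
  guess \<open>z\<close> and to prove two inequalities.

  The guess comes from the decomposition of an avalanche into waves. In a full \<open>N \<times> N\<close> square of
  critical vertices every wave topples a concentric square once, and the next wave topples the square
  one layer further in, as long as that square still contains the starting vertex \<open>y\<close>. With \<open>depth w\<close>
  the number of concentric squares containing \<open>w\<close> (1 on the outermost layer), \<open>w\<close> topples
  \<open>min (depth w) (depth y)\<close> times. Emptying a corner \<open>h\<close> of the concentric square at depth \<open>D\<close>
  changes this in one place only. As long as all four neighbours of \<open>h\<close> topple, \<open>h\<close> receives four
  grains and topples as well; in the wave of its own layer it gets only two and stays put. So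
  \<open>h\<close> behaves as if its depth were \<open>D - 1\<close>, and every wave still reaches all other vertices, because
  a square without one point is connected. Outside the square nothing topples: by maximality of the
  generator an adjacent vertex holds at most two grains, it has only one neighbour in the square, and
  that neighbour topples at most once. An avalanche started at \<open>h\<close> itself is empty.

  For the count, write \<open>min (depth w) (depth y)\<close> as the number of levels \<open>t\<close> that are at most both
  depths. The concentric square of level \<open>t\<close> has \<open>(N - 2 t + 2)\<^sup>2\<close> points, so summing over \<open>w\<close> and \<open>y\<close>
  gives the sum of the fourth powers of the sides. The start \<open>y = h\<close> removes the sum of the squared
  sides over \<open>t \<le> D\<close>, and the missing toppling of \<open>h\<close> removes one for each of the other starting
  vertices of depth at least \<open>D\<close> (\<open>sum_avalanche_size_holed_square\<close>). Both power sums telescope, and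
  \<open>D = \<lceil>N/2\<rceil> + 1 - k\<close> gives the formula.
\<close>

section \<open>Toppling functions and the least action principle\<close>

text \<open>
  The discrete Laplacian on \<open>\<int>\<^sup>2\<close>. Toppling each vertex \<open>p\<close> \<open>f p\<close> times adds \<open>lap f\<close> to a sandpile,
  provided that \<open>f\<close> vanishes off the grid.
\<close>

definition lap :: "(vertex \<Rightarrow> int) \<Rightarrow> vertex \<Rightarrow> int" where
  "lap f p = f (fst p + 1, snd p) + f (fst p - 1, snd p) + f (fst p, snd p + 1)
     + f (fst p, snd p - 1) - 4 * f p"

definition stabilises :: "nat \<Rightarrow> sandpile \<Rightarrow> (vertex \<Rightarrow> int) \<Rightarrow> bool" where
  "stabilises L \<eta> z \<longleftrightarrow> (\<forall>w. 0 \<le> z w) \<and> (\<forall>w. w \<notin> grid L \<longrightarrow> z w = 0) \<and>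
     (\<forall>w\<in>grid L. \<eta> w + lap z w \<le> 3)"

lemma finite_grid: "finite (grid L)"
  by (simp add: grid_def)

lemma nbr_iff: "nbr p q \<longleftrightarrow> q \<in> {(fst p + 1, snd p), (fst p - 1, snd p),
    (fst p, snd p + 1), (fst p, snd p - 1)}"
  unfolding nbr_def by (cases p; cases q; auto; presburger)

lemma lap_indicator:
  "lap (\<lambda>p. of_bool (p = v)) w = (if w = v then - 4 else of_bool (nbr w v))"
proof -
  obtain x y where w: "w = (x, y)" by fastforce
  consider "v = w" | "v = (x + 1, y)" | "v = (x - 1, y)" | "v = (x, y + 1)" | "v = (x, y - 1)"
    | "v \<noteq> w" "v \<notin> {(x + 1, y), (x - 1, y), (x, y + 1), (x, y - 1)}" by blast
  then show ?thesis
    by cases (auto simp: w lap_def nbr_iff)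
qed

lemma topple_lap:
  "w \<in> grid L \<Longrightarrow> topple L v \<eta> w = \<eta> w + lap (\<lambda>p. of_bool (p = v)) w"
  by (simp add: topple_def lap_indicator)

lemma lap_add: "lap (\<lambda>p. f p + g p) w = lap f w + lap g w"
  by (simp add: lap_def)

lemma lap_diff: "lap (\<lambda>p. f p - g p) w = lap f w - lap g w"
  by (simp add: lap_def)

lemma lap_const [simp]: "lap (\<lambda>_. c) p = 0"
  by (simp add: lap_def)

text \<open>
  Neighbouring values enter the Laplacian positively. The term \<open>4 * f p\<close> cancels the centre, so that
  only the neighbours have to be compared.
\<close>

lemma lap_mono:
  assumes "\<And>q. nbr p q \<Longrightarrow> f q \<le> g q"
  shows "lap f p + 4 * f p \<le> lap g p + 4 * g p"
  unfolding lap_def by (simp, intro add_mono assms) (simp_all add: nbr_iff)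

lemma lap_strict_mono:
  assumes le: "\<And>q. nbr p q \<Longrightarrow> f q \<le> g q" and q: "nbr p q" "f q < g q"
  shows "lap f p + 4 * f p < lap g p + 4 * g p"
proof -
  have "f r + of_bool (r = q) \<le> g r" if "nbr p r" for r
    using le[OF that] q(2) by simp
  from lap_mono[of p "\<lambda>r. f r + of_bool (r = q)", OF this]
  have "lap f p + of_bool (p \<noteq> q) + 4 * f p \<le> lap g p + 4 * g p"
    using q(1) by (simp add: lap_add lap_indicator split: if_splits)
  moreover have "p \<noteq> q" using q(1) by (auto simp: nbr_def)
  ultimately show ?thesis by simp
qed

text \<open>
  The least action principle: a vertex that topples legally holds more than three grains, so every
  stabilising function must topple it at least once. Remove this toppling from both sides and induct.
\<close>

lemma legal_topplings_odometer:
  assumes "legal_topplings L \<eta> n \<xi>"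
  shows "\<exists>u. (\<forall>w. 0 \<le> u w) \<and> (\<forall>w. w \<notin> grid L \<longrightarrow> u w = 0) \<and> (\<Sum>w\<in>grid L. u w) = int n \<and>
    (\<forall>w\<in>grid L. \<xi> w = \<eta> w + lap u w) \<and> (\<forall>z w. stabilises L \<eta> z \<longrightarrow> u w \<le> z w)"
  using assms
proof (induction rule: legal_topplings.induct)
  case (none \<eta>)
  show ?case
    by (rule exI[of _ "\<lambda>_. 0"]) (auto simp: lap_def stabilises_def)
next
  case (step v \<eta> n \<xi>)
  let ?e = "\<lambda>p. of_bool (p = v) :: int"
  obtain u where u: "\<And>w. 0 \<le> u w" "\<And>w. w \<notin> grid L \<Longrightarrow> u w = 0"
    "(\<Sum>w\<in>grid L. u w) = int n" "\<And>w. w \<in> grid L \<Longrightarrow> \<xi> w = topple L v \<eta> w + lap u w"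
    "\<And>z w. stabilises L (topple L v \<eta>) z \<Longrightarrow> u w \<le> z w"
    using step.IH by blast
  have least: "u w + ?e w \<le> z w" if z: "stabilises L \<eta> z" for z w
  proof -
    have z0: "0 \<le> z p" for p using z unfolding stabilises_def by blast
    have "\<eta> v + lap z v \<le> 3" using z step.hyps(1) by (simp add: stabilises_def)
    moreover have "lap z v \<ge> - 4 * z v" unfolding lap_def using z0 by (simp add: add_nonneg_nonneg)
    ultimately have "z v \<ge> 1" using step.hyps(2) by linarith
    then have "stabilises L (topple L v \<eta>) (\<lambda>p. z p - ?e p)"
      using z step.hyps(1) by (auto simp: stabilises_def topple_lap lap_diff)
    from u(5)[OF this, of w] show ?thesis by simp
  qed
  have "(\<Sum>w\<in>grid L. u w + ?e w) = int (Suc n)"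
    using u(3) step.hyps(1) finite_grid[of L] by (simp add: sum.distrib of_bool_def)
  then show ?case
    using u(1,2,4) step.hyps(1) least
    by (intro exI[of _ "\<lambda>p. u p + ?e p"]) (auto simp: topple_lap lap_add)
qed

lemma legal_topplings_snoc:
  assumes "legal_topplings L \<eta> n \<xi>" "v \<in> grid L" "\<xi> v > 3"
  shows "legal_topplings L \<eta> (Suc n) (topple L v \<xi>)"
  using assms by induction (auto intro: legal_topplings.intros)

lemma legal_topplings_nonneg:
  assumes "legal_topplings L \<eta> n \<xi>" "\<forall>w\<in>grid L. 0 \<le> \<eta> w"
  shows "\<forall>w\<in>grid L. 0 \<le> \<xi> w"
  using assms by induction (auto simp: topple_def)

text \<open>
  Any stabilising function bounds the length of legal sequences, so a longest one exists, and it can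
  only end in a stable sandpile.
\<close>

lemma stabilising_sequence_exists:
  assumes z: "stabilises L \<eta> z" and nonneg: "\<forall>w\<in>grid L. 0 \<le> \<eta> w"
  shows "\<exists>n. \<exists>\<xi>\<in>stable_sandpiles L. legal_topplings L \<eta> n \<xi>"
proof -
  have bound: "n \<le> nat (\<Sum>w\<in>grid L. z w)" if "\<exists>\<xi>. legal_topplings L \<eta> n \<xi>" for n
  proof -
    from that obtain \<xi> where \<xi>: "legal_topplings L \<eta> n \<xi>" by blast
    obtain u where u: "(\<Sum>w\<in>grid L. u w) = int n" "\<forall>z w. stabilises L \<eta> z \<longrightarrow> u w \<le> z w"
      using legal_topplings_odometer[OF \<xi>] by (elim exE conjE)
    then have "\<And>w. u w \<le> z w" using z by blast
    with u(1) show ?thesis using sum_mono[of "grid L" u z] by simp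
  qed
  define P where "P n = (\<exists>\<xi>. legal_topplings L \<eta> n \<xi>)" for n
  have "P 0" unfolding P_def using legal_topplings.none by blast
  moreover have "\<forall>n. P n \<longrightarrow> n \<le> nat (\<Sum>w\<in>grid L. z w)" using bound unfolding P_def by blast
  ultimately obtain n where "P n" and max: "\<And>n'. P n' \<Longrightarrow> n' \<le> n"
    using Nat.ex_has_greatest_nat[of P 0] by blast
  then obtain \<xi> where n: "legal_topplings L \<eta> n \<xi>" unfolding P_def by blast
  have "\<xi> w < 4" if "w \<in> grid L" for w
  proof (rule ccontr)
    assume "\<not> \<xi> w < 4"
    then have "legal_topplings L \<eta> (Suc n) (topple L w \<xi>)"
      using legal_topplings_snoc[OF n that] by simp
    then have "P (Suc n)" unfolding P_def by blast
    then show False using max by fastforce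
  qed
  then have "\<xi> \<in> stable_sandpiles L"
    using legal_topplings_nonneg[OF n nonneg] by (auto simp: stable_sandpiles_def)
  then show ?thesis using n by blast
qed

text \<open>
  The odometer of a legal stabilising sequence is itself stabilising and lies below every stabilising
  function. Hence it is the least one, whatever the sequence.
\<close>

theorem avalanche_size_eq_least_stabiliser:
  assumes nonneg: "\<forall>w\<in>grid L. 0 \<le> \<eta> w"
    and z: "stabilises L (add_grain v \<eta>) z"
    and least: "\<And>u w. stabilises L (add_grain v \<eta>) u \<Longrightarrow> z w \<le> u w"
  shows "int (avalanche_size L \<eta> v) = (\<Sum>w\<in>grid L. z w)"
proof -
  define \<zeta> where "\<zeta> = add_grain v \<eta>"
  have nonneg': "\<forall>w\<in>grid L. 0 \<le> \<zeta> w" using nonneg by (simp add: \<zeta>_def add_grain_def)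
  have len: "int n = (\<Sum>w\<in>grid L. z w)"
    if n: "legal_topplings L \<zeta> n \<xi>" and \<xi>: "\<xi> \<in> stable_sandpiles L" for n \<xi>
  proof -
    obtain u where u: "\<forall>w. 0 \<le> u w" "\<forall>w. w \<notin> grid L \<longrightarrow> u w = 0"
      "(\<Sum>w\<in>grid L. u w) = int n" "\<forall>w\<in>grid L. \<xi> w = \<zeta> w + lap u w"
      "\<forall>z w. stabilises L \<zeta> z \<longrightarrow> u w \<le> z w"
      using legal_topplings_odometer[OF n] by (elim exE conjE)
    have "\<forall>w\<in>grid L. \<zeta> w + lap u w \<le> 3"
      using u(4) \<xi> by (fastforce simp: stable_sandpiles_def)
    then have "stabilises L \<zeta> u"
      unfolding stabilises_def using u(1,2) by blast
    then have "z w \<le> u w" for w by (rule least[folded \<zeta>_def])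
    moreover have "u w \<le> z w" for w using u(5) z unfolding \<zeta>_def by blast
    ultimately have "u w = z w" for w by (meson antisym)
    then show ?thesis using u(3) by simp
  qed
  obtain n \<xi> where n: "\<xi> \<in> stable_sandpiles L" "legal_topplings L \<zeta> n \<xi>"
    using stabilising_sequence_exists[OF z[folded \<zeta>_def] nonneg'] by blast
  have "n' = n" if "\<exists>\<xi>\<in>stable_sandpiles L. legal_topplings L \<zeta> n' \<xi>" for n'
  proof -
    from that obtain \<xi>' where "\<xi>' \<in> stable_sandpiles L" "legal_topplings L \<zeta> n' \<xi>'" by blast
    from len[OF this(2,1)] len[OF n(2,1)] show ?thesis by linarith
  qed
  then have size: "avalanche_size L \<eta> v = n"
    unfolding avalanche_size_def \<zeta>_def[symmetric] using n by (intro the_equality) blast+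
  show ?thesis unfolding size by (rule len[OF n(2,1)])
qed

section \<open>Depth in a square\<close>

text \<open>
  The square has its lowest corner at \<open>(a, b)\<close> and side \<open>n\<close>. The depth is the distance to the
  complement of the square, in the direction of the nearest side.
\<close>

definition depth :: "int \<Rightarrow> int \<Rightarrow> int \<Rightarrow> vertex \<Rightarrow> int" where
  "depth a b n p = max 0 (min (min (fst p - a + 1) (a + n - fst p))
                              (min (snd p - b + 1) (b + n - snd p)))"

text \<open>
  For \<open>t \<ge> 1\<close> the points of depth at least \<open>t\<close>; the whole square is \<open>subsquare a b n 1\<close>.
\<close>

definition subsquare :: "int \<Rightarrow> int \<Rightarrow> int \<Rightarrow> int \<Rightarrow> vertex set" where
  "subsquare a b n t = {a + t - 1..a + n - t} \<times> {b + t - 1..b + n - t}"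

lemma depth_ge_iff: "1 \<le> t \<Longrightarrow> t \<le> depth a b n p \<longleftrightarrow> p \<in> subsquare a b n t"
  by (cases p) (auto simp: depth_def subsquare_def)

lemma depth_nonneg: "0 \<le> depth a b n p"
  by (simp add: depth_def)

lemma depth_le: "0 \<le> n \<Longrightarrow> 2 * depth a b n p \<le> n + 1"
  by (auto simp: depth_def max_def min_def)

text \<open>
  The depth is a minimum of four affine functions, cut off at zero. Arguing with one of these that
  attains the minimum replaces case distinctions over nested minima.
\<close>

definition side_distances :: "int \<Rightarrow> int \<Rightarrow> int \<Rightarrow> (vertex \<Rightarrow> int) set" where
  "side_distances a b n =
     {\<lambda>p. fst p - a + 1, \<lambda>p. a + n - fst p, \<lambda>p. snd p - b + 1, \<lambda>p. b + n - snd p}"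

lemma depth_le_side:
  assumes "g \<in> side_distances a b n" shows "depth a b n p \<le> max 0 (g p)"
proof -
  have "min (min (fst p - a + 1) (a + n - fst p)) (min (snd p - b + 1) (b + n - snd p)) \<le> g p"
    using assms unfolding side_distances_def by (elim insertE emptyE) (simp_all add: min_le_iff_disj)
  then show ?thesis unfolding depth_def by (rule max.mono[OF order_refl])
qed

lemma depth_attained:
  obtains g where "g \<in> side_distances a b n" "depth a b n p = max 0 (g p)"
proof -
  define m where
    "m = min (min (fst p - a + 1) (a + n - fst p)) (min (snd p - b + 1) (b + n - snd p))"
  have "m = fst p - a + 1 \<or> m = a + n - fst p \<or> m = snd p - b + 1 \<or> m = b + n - snd p"
    unfolding m_def min_def by (simp split: if_split)
  then have "\<exists>g\<in>side_distances a b n. m = g p"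
    unfolding side_distances_def by simp
  then obtain g where g: "g \<in> side_distances a b n" "m = g p" ..
  have "depth a b n p = max 0 m" unfolding depth_def m_def ..
  with g show ?thesis using that by simp
qed

lemma side_nbr:
  assumes "g \<in> side_distances a b n" "nbr p q" shows "\<bar>g p - g q\<bar> \<le> 1"
  using assms unfolding side_distances_def nbr_def by (elim insertE emptyE) simp_all

lemma depth_nbr:
  assumes "nbr p q" shows "depth a b n q \<le> depth a b n p + 1"
proof -
  obtain g where g: "g \<in> side_distances a b n" "depth a b n p = max 0 (g p)"
    by (rule depth_attained)
  then show ?thesis using depth_le_side[OF g(1), of q] side_nbr[OF g(1) assms] by linarith
qed

text \<open>
  At \<open>p\<close> the depth agrees with an affine, hence harmonic, function that lies above it at all
  neighbours.
\<close>

lemma depth_superharmonic: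
  assumes "p \<in> subsquare a b n 1" shows "lap (depth a b n) p \<le> 0"
proof -
  obtain g where g: "g \<in> side_distances a b n" "depth a b n p = max 0 (g p)"
    by (rule depth_attained)
  have pos: "1 \<le> g p" using g(2) assms depth_ge_iff[of 1 a b n p] by linarith
  then have "depth a b n q \<le> g q" if "nbr p q" for q
    using side_nbr[OF g(1) that] depth_le_side[OF g(1), of q] by linarith
  then have "lap (depth a b n) p + 4 * depth a b n p \<le> lap g p + 4 * g p"
    by (rule lap_mono)
  moreover have "lap g p = 0"
    using g(1) unfolding side_distances_def lap_def by (elim insertE emptyE) simp_all
  ultimately show ?thesis using g(2) pos by linarith
qed

lemma depth_descends:
  assumes "p \<in> subsquare a b n 1"
  obtains q where "nbr p q" "depth a b n q < depth a b n p"
proof -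
  obtain g where g: "g \<in> side_distances a b n" "depth a b n p = max 0 (g p)"
    by (rule depth_attained)
  have pos: "1 \<le> g p" using g(2) assms depth_ge_iff[of 1 a b n p] by linarith
  have "\<exists>q\<in>{(fst p + 1, snd p), (fst p - 1, snd p), (fst p, snd p + 1), (fst p, snd p - 1)}.
      g q = g p - 1"
    using g(1) unfolding side_distances_def by (elim insertE emptyE) simp_all
  then obtain q where q: "nbr p q" "g q = g p - 1" unfolding nbr_iff by blast
  have "depth a b n q < depth a b n p"
    using depth_le_side[OF g(1), of q] q(2) g(2) pos by linarith
  then show ?thesis using that q(1) by blast
qed

text \<open>
  A vertex with two neighbours in a rectangle lies between them or shares a different coordinate
  with each; in both cases it belongs to the rectangle.
\<close>

lemma outside_nbr_unique:
  assumes "w \<notin> subsquare a b n 1" "p \<in> subsquare a b n 1" "q \<in> subsquare a b n 1"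
    and "nbr w p" "nbr w q"
  shows "p = q"
proof -
  obtain x y where w: "w = (x, y)" by fastforce
  show ?thesis
    using assms(4,5) unfolding nbr_iff w
    by (elim insertE emptyE) (use assms(1-3) in \<open>auto simp: w subsquare_def\<close>)
qed

lemma int_interval_spread:
  fixes i j l m :: int
  assumes "P i" "i \<in> {l..m}" "j \<in> {l..m}"
    and step: "\<And>i j. P i \<Longrightarrow> i \<in> {l..m} \<Longrightarrow> j \<in> {l..m} \<Longrightarrow> \<bar>i - j\<bar> = 1 \<Longrightarrow> P j"
  shows "P j"
proof (cases "i \<le> j")
  case True
  then have "j \<le> m \<longrightarrow> P j"
  proof (induction j rule: int_ge_induct)
    case base show ?case using assms(1) by simp
  next
    case (step k) then show ?case using assms(2) assms(4)[of k "k + 1"] by auto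
  qed
  then show ?thesis using assms(3) by simp
next
  case False
  then have "j \<le> i" by simp
  then have "l \<le> j \<longrightarrow> P j"
  proof (induction j rule: int_le_induct)
    case base show ?case using assms(1) by simp
  next
    case (step k) then show ?case using assms(2) assms(4)[of k "k - 1"] by auto
  qed
  then show ?thesis using assms(3) by simp
qed

text \<open>
  A rectangle with both sides at least two stays connected when a point \<open>h\<close> is removed. Every
  remaining point lies on a row or on a column that avoids \<open>h\<close>, and any row and any column that avoid
  \<open>h\<close> cross. So all points can be reached from the crossing of one such row and column.
\<close>

lemma rectangle_minus_point_spread:
  fixes x1 x2 y1 y2 :: int and h :: vertex
  defines "Q \<equiv> {x1..x2} \<times> {y1..y2} - {h}"
  assumes "x1 < x2" "y1 < y2" and start: "p \<in> T" "p \<in> Q"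
    and step: "\<And>p q. p \<in> T \<Longrightarrow> p \<in> Q \<Longrightarrow> q \<in> Q \<Longrightarrow> nbr p q \<Longrightarrow> q \<in> T"
  shows "Q \<subseteq> T"
proof -
  have col: "(x, j) \<in> T" if "(x, i) \<in> T" "x \<noteq> fst h" "x \<in> {x1..x2}" "i \<in> {y1..y2}" "j \<in> {y1..y2}"
    for x i j
  proof (rule int_interval_spread[of "\<lambda>i. (x, i) \<in> T", OF that(1,4,5)])
    fix i j assume "(x, i) \<in> T" "i \<in> {y1..y2}" "j \<in> {y1..y2}" "\<bar>i - j\<bar> = 1"
    then show "(x, j) \<in> T"
      using that(2,3) by (intro step[of "(x, i)" "(x, j)"]) (auto simp: Q_def nbr_def)
  qed
  have row: "(j, y) \<in> T" if "(i, y) \<in> T" "y \<noteq> snd h" "y \<in> {y1..y2}" "i \<in> {x1..x2}" "j \<in> {x1..x2}"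
    for y i j
  proof (rule int_interval_spread[of "\<lambda>i. (i, y) \<in> T", OF that(1,4,5)])
    fix i j assume "(i, y) \<in> T" "i \<in> {x1..x2}" "j \<in> {x1..x2}" "\<bar>i - j\<bar> = 1"
    then show "(j, y) \<in> T"
      using that(2,3) by (intro step[of "(i, y)" "(j, y)"]) (auto simp: Q_def nbr_def)
  qed
  define x0 where "x0 = (if fst h = x1 then x2 else x1)"
  define y0 where "y0 = (if snd h = y1 then y2 else y1)"
  have x0: "x0 \<in> {x1..x2}" "x0 \<noteq> fst h" and y0: "y0 \<in> {y1..y2}" "y0 \<noteq> snd h"
    using assms(2,3) by (auto simp: x0_def y0_def)
  obtain x y where p: "p = (x, y)" by fastforce
  have xy: "x \<in> {x1..x2}" "y \<in> {y1..y2}" "x \<noteq> fst h \<or> y \<noteq> snd h"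
    using start(2) by (auto simp: p Q_def)
  have centre: "(x0, y0) \<in> T"
  proof (cases "x = fst h")
    case False
    then have "(x, y0) \<in> T" using col xy y0(1) start(1) p by blast
    then show ?thesis using row xy x0(1) y0 by blast
  next
    case True
    then have "(x0, y) \<in> T" using row xy x0(1) start(1) p by blast
    then show ?thesis using col xy x0 y0(1) by blast
  qed
  show ?thesis
  proof
    fix q assume q: "q \<in> Q"
    obtain x y where qxy: "q = (x, y)" by fastforce
    have xy: "x \<in> {x1..x2}" "y \<in> {y1..y2}" "x \<noteq> fst h \<or> y \<noteq> snd h"
      using q by (auto simp: qxy Q_def)
    show "q \<in> T"
    proof (cases "x = fst h")
      case False
      have "(x, y0) \<in> T" using row centre y0 x0(1) xy by blast
      then show ?thesis using col False xy y0(1) qxy by blast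
    next
      case True
      have "(x0, y) \<in> T" using col centre x0 y0(1) xy by blast
      then show ?thesis using row True xy x0(1) qxy by blast
    qed
  qed
qed

section \<open>Counting by depth\<close>

text \<open>
  The layer-cake form of the minimum, which turns sums of minima into products of level counts.
\<close>

lemma min_eq_sum_levels:
  fixes i j M :: int
  assumes "0 \<le> i" "0 \<le> j" "j \<le> M"
  shows "min i j = (\<Sum>t\<in>{1..M}. of_bool (t \<le> i) * of_bool (t \<le> j))"
proof -
  have "(\<Sum>t\<in>{1..M}. of_bool (t \<le> i) * of_bool (t \<le> j)) =
      (\<Sum>t\<in>{1..M}. if t \<le> min i j then 1 else 0 :: int)"
    by (intro sum.cong) auto
  also have "\<dots> = (\<Sum>t | t \<in> {1..M} \<and> t \<le> min i j. 1)"
    by (rule sum.inter_filter[symmetric]) simp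
  also have "{t \<in> {1..M}. t \<le> min i j} = {1..min i j}" using assms by auto
  finally show ?thesis using assms by simp
qed

lemma sum_depth_ge:
  assumes "1 \<le> t" "2 * t \<le> n + 2"
  shows "(\<Sum>w\<in>subsquare a b n 1. of_bool (t \<le> depth a b n w)) = (n - 2 * t + 2)\<^sup>2"
proof -
  have "(\<Sum>w\<in>subsquare a b n 1. of_bool (t \<le> depth a b n w)) =
      (\<Sum>w | w \<in> subsquare a b n 1 \<and> t \<le> depth a b n w. 1 :: int)"
    unfolding of_bool_def by (rule sum.inter_filter[symmetric]) (simp add: subsquare_def)
  also have "{w \<in> subsquare a b n 1. t \<le> depth a b n w} = subsquare a b n t"
    unfolding depth_ge_iff[OF assms(1)] using assms(1) by (auto simp: subsquare_def)
  also have "(\<Sum>w\<in>subsquare a b n t. 1) = int (card (subsquare a b n t))"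
    by simp
  also have "\<dots> = int (card {a + t - 1..a + n - t}) * int (card {b + t - 1..b + n - t})"
    by (simp only: subsquare_def card_cartesian_product of_nat_mult)
  finally have "(\<Sum>w\<in>subsquare a b n 1. of_bool (t \<le> depth a b n w)) =
      int (card {a + t - 1..a + n - t}) * int (card {b + t - 1..b + n - t})" .
  moreover have "int (card {a + t - 1..a + n - t}) = n - 2 * t + 2"
    "int (card {b + t - 1..b + n - t}) = n - 2 * t + 2"
    using assms(2) by simp_all
  ultimately show ?thesis by (simp only: power2_eq_square)
qed

text \<open>
  Telescoping: \<open>s (s + 1) (s + 2) / 6\<close> increases by \<open>s\<^sup>2\<close> from \<open>s - 2\<close> to \<open>s\<close>.
\<close>

lemma sum_squares_step2:
  fixes n D :: int
  assumes "0 \<le> D"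
  shows "6 * (\<Sum>t\<in>{1..D}. (n - 2 * t + 2)\<^sup>2) =
    (n ^ 3 + 3 * n\<^sup>2 + 2 * n) - ((n - 2 * D) ^ 3 + 3 * (n - 2 * D)\<^sup>2 + 2 * (n - 2 * D))"
  using assms
proof (induction D rule: int_ge_induct)
  case (step D)
  have "{1..D + 1} = insert (D + 1) {1..D}" using step.hyps by auto
  then show ?case
    using step.IH by (simp add: algebra_simps power2_eq_square power3_eq_cube)
qed simp

text \<open>
  Telescoping: \<open>(3 s\<^sup>5 + 15 s\<^sup>4 + 20 s\<^sup>3 - 8 s) / 30\<close> increases by \<open>s\<^sup>4\<close> from \<open>s - 2\<close> to \<open>s\<close>. It
  vanishes at \<open>0\<close> and at \<open>- 1\<close>, the two possible ends of the sum over all layers.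
\<close>

lemma sum_fourth_powers_step2:
  fixes n D :: int
  assumes "0 \<le> D"
  shows "30 * (\<Sum>t\<in>{1..D}. (n - 2 * t + 2) ^ 4) =
    (3 * n ^ 5 + 15 * n ^ 4 + 20 * n ^ 3 - 8 * n) -
    (3 * (n - 2 * D) ^ 5 + 15 * (n - 2 * D) ^ 4 + 20 * (n - 2 * D) ^ 3 - 8 * (n - 2 * D))"
  using assms
proof (induction D rule: int_ge_induct)
  case (step D)
  define s where "s = n - 2 * D"
  have "30 * s ^ 4 = (3 * s ^ 5 + 15 * s ^ 4 + 20 * s ^ 3 - 8 * s) -
      (3 * (s - 2) ^ 5 + 15 * (s - 2) ^ 4 + 20 * (s - 2) ^ 3 - 8 * (s - 2))"
    by (simp add: algebra_simps eval_nat_numeral)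
  moreover have s: "n - 2 * (D + 1) = s - 2" "n - 2 * (D + 1) + 2 = s" by (simp_all add: s_def)
  moreover have "{1..D + 1} = insert (D + 1) {1..D}" using step.hyps by auto
  then have "(\<Sum>t\<in>{1..D + 1}. (n - 2 * t + 2) ^ 4) =
      (n - 2 * (D + 1) + 2) ^ 4 + (\<Sum>t\<in>{1..D}. (n - 2 * t + 2) ^ 4)"
    by simp
  then have "(\<Sum>t\<in>{1..D + 1}. (n - 2 * t + 2) ^ 4) = s ^ 4 + (\<Sum>t\<in>{1..D}. (n - 2 * t + 2) ^ 4)"
    unfolding s(2) .
  ultimately show ?case
    using step.IH unfolding s(1) s_def[symmetric] by linarith
qed simp

section \<open>The toppling function of an avalanche in a square with a hole\<close>

text \<open>
  The sandpile after the removal: an \<open>n \<times> n\<close> square of critical vertices whose neighbours are not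
  critical, with one emptied vertex \<open>h\<close> at a corner of the concentric square of depth \<open>D\<close>. The
  condition \<open>2 * D \<le> n\<close> says that this concentric square is more than a single point.
\<close>

locale holed_square =
  fixes L :: nat and \<eta> :: sandpile and a b n D :: int and h :: vertex
  assumes range: "\<And>w. w \<in> grid L \<Longrightarrow> 0 \<le> \<eta> w \<and> \<eta> w \<le> 3"
    and in_grid: "subsquare a b n 1 \<subseteq> grid L"
    and full: "\<And>w. w \<in> subsquare a b n 1 \<Longrightarrow> w \<noteq> h \<Longrightarrow> \<eta> w = 3"
    and border: "\<And>w p. w \<in> grid L \<Longrightarrow> w \<notin> subsquare a b n 1 \<Longrightarrow> p \<in> subsquare a b n 1 \<Longrightarrow>
           nbr w p \<Longrightarrow> \<eta> w \<le> 2"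
    and empty: "\<eta> h = 0"
    and D: "1 \<le> D" "2 * D \<le> n"
    and corner: "h \<in> {a + D - 1, a + n - D} \<times> {b + D - 1, b + n - D}"
begin

abbreviation d :: "vertex \<Rightarrow> int" where "d \<equiv> depth a b n"

text \<open>
  The depth with the hole counted one layer further out. A start at \<open>y \<noteq> h\<close> makes \<open>p\<close> topple
  \<open>min (rdepth p) (d y)\<close> times.
\<close>

definition rdepth :: "vertex \<Rightarrow> int" where "rdepth p = d p - of_bool (p = h)"

lemma depth_hole: "d h = D"
  using corner D by (auto simp: depth_def)

lemma hole_in_square: "h \<in> subsquare a b n 1"
  using corner D by (auto simp: subsquare_def)

lemma depth_nbr_hole: "nbr h q \<Longrightarrow> d q \<le> D"
  using corner D by (auto simp: depth_def nbr_iff min_le_iff_disj)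

text \<open>
  A corner of its concentric square has two neighbours in the next layer outwards, so lowering the
  hole by one layer raises the Laplacian there to no more than two.
\<close>

lemma lap_depth_hole: "lap d h \<le> - 2"
proof -
  obtain x y where h: "h = (x, y)" by fastforce
  have "d (x + 1, y) \<le> D" "d (x - 1, y) \<le> D" "d (x, y + 1) \<le> D" "d (x, y - 1) \<le> D"
    using depth_nbr_hole by (simp_all add: nbr_iff h)
  moreover have "d (x + 1, y) \<le> D - 1 \<or> d (x - 1, y) \<le> D - 1"
    using corner D(1) by (auto simp: h depth_def min_le_iff_disj)
  moreover have "d (x, y + 1) \<le> D - 1 \<or> d (x, y - 1) \<le> D - 1"
    using corner D(1) by (auto simp: h depth_def min_le_iff_disj)
  ultimately show ?thesis using depth_hole unfolding lap_def h fst_conv snd_conv by linarith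
qed

lemma rdepth_nonneg: "0 \<le> rdepth p"
  using depth_nonneg[of a b n p] depth_hole D by (auto simp: rdepth_def)

lemma rdepth_le: "rdepth p \<le> d p"
  by (simp add: rdepth_def)

text \<open>
  Lowering the depth at a single point could break the Lipschitz bound, but no neighbour of the
  corner \<open>h\<close> is deeper than \<open>h\<close>.
\<close>

lemma rdepth_nbr: "nbr p q \<Longrightarrow> rdepth p \<le> rdepth q + 1"
proof -
  assume pq: "nbr p q"
  then have "nbr q p" by (simp add: nbr_def abs_minus_commute)
  then have "d p \<le> d q + 1" using depth_nbr by blast
  moreover have "d p \<le> D" if "q = h" using that \<open>nbr q p\<close> depth_nbr_hole by blast
  ultimately show ?thesis
    using depth_hole by (cases "q = h"; cases "p = h") (auto simp: rdepth_def)
qed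

lemma depth_pos_iff: "1 \<le> d p \<longleftrightarrow> p \<in> subsquare a b n 1"
  using depth_ge_iff[of 1] by simp

lemma lap_min_le:
  assumes "rdepth w < c" shows "lap (\<lambda>p. min (rdepth p) c) w \<le> lap d w + 4 * of_bool (w = h)"
proof -
  have "lap (\<lambda>p. min (rdepth p) c) w + 4 * min (rdepth w) c \<le> lap d w + 4 * d w"
    by (rule lap_mono) (simp add: rdepth_le min.coboundedI1)
  then show ?thesis using assms by (simp add: rdepth_def split: if_splits)
qed

lemma lap_min_saturated:
  assumes "c \<le> rdepth w" shows "lap (\<lambda>p. min (rdepth p) c) w \<le> 0"
  using lap_mono[of w "\<lambda>p. min (rdepth p) c" "\<lambda>_. c"] assms by simp

text \<open>
  The start holds four grains and needs a net loss. It has one: some neighbour lies in the next layer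
  outwards, which topples one time less.
\<close>

lemma lap_min_start:
  assumes "y \<in> subsquare a b n 1" "y \<noteq> h" shows "lap (\<lambda>p. min (rdepth p) (d y)) y \<le> - 1"
proof -
  obtain q where q: "nbr y q" "d q < d y" using depth_descends[OF assms(1)] .
  then have "min (rdepth q) (d y) < d y" using rdepth_le[of q] by linarith
  from lap_strict_mono[OF _ q(1), of "\<lambda>p. min (rdepth p) (d y)" "\<lambda>_. d y", OF _ this]
  show ?thesis using assms(2) by (simp add: rdepth_def)
qed

text \<open>
  A vertex outside has at most one neighbour in the square, and this neighbour, being on the
  outermost layer, topples at most once.
\<close>

lemma lap_outside:
  assumes "w \<notin> subsquare a b n 1" "0 \<le> c"
  shows "lap (\<lambda>p. min (rdepth p) c) w \<le> of_bool (\<exists>p\<in>subsquare a b n 1. nbr w p)"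
proof -
  have d0: "d p = 0" if "p \<notin> subsquare a b n 1" for p
    using that depth_pos_iff[of p] depth_nonneg[of a b n p] by linarith
  have w0: "min (rdepth w) c = 0"
    using d0[OF assms(1)] assms hole_in_square by (auto simp: rdepth_def)
  show ?thesis
  proof (cases "\<exists>p\<in>subsquare a b n 1. nbr w p")
    case True
    then obtain p where p: "p \<in> subsquare a b n 1" "nbr w p" by blast
    have pw: "p \<noteq> w" using p assms(1) by blast
    have "min (rdepth q) c \<le> of_bool (q = p)" if q: "nbr w q" for q
    proof (cases "q = p")
      case True
      have "d p \<le> 1" using depth_nbr[OF p(2), of a b n] d0[OF assms(1)] by simp
      then show ?thesis using True rdepth_le[of p] by simp
    next
      case False
      then have "q \<notin> subsquare a b n 1" using outside_nbr_unique assms(1) p q by blast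
      then show ?thesis using d0[of q] rdepth_le[of q] False by simp
    qed
    from lap_mono[of w "\<lambda>q. min (rdepth q) c", OF this]
    show ?thesis using True w0 p(2) pw by (simp add: lap_indicator)
  next
    case False
    have "min (rdepth q) c = 0" if "nbr w q" for q
    proof -
      have "q \<notin> subsquare a b n 1" using False that by blast
      then show ?thesis using d0 hole_in_square assms(2) by (auto simp: rdepth_def)
    qed
    then show ?thesis using False lap_mono[of w "\<lambda>p. min (rdepth p) c" "\<lambda>_. 0"] w0 by simp
  qed
qed

lemma avalanche_stabilises:
  assumes y: "y \<in> subsquare a b n 1" "y \<noteq> h"
  shows "stabilises L (add_grain y \<eta>) (\<lambda>p. min (rdepth p) (d y))"
proof -
  let ?z = "\<lambda>p. min (rdepth p) (d y)"
  have "?z w = 0" if "w \<notin> grid L" for w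
    using that in_grid hole_in_square depth_nonneg[of a b n w] depth_nonneg[of a b n y] depth_pos_iff[of w]
    by (auto simp: rdepth_def)
  moreover have "add_grain y \<eta> w + lap ?z w \<le> 3" if w: "w \<in> grid L" for w
  proof -
    consider "w = y" | "w = h" | "w \<in> subsquare a b n 1" "w \<noteq> y" "w \<noteq> h"
      | "w \<notin> subsquare a b n 1" by blast
    then show ?thesis
    proof cases
      case 1
      then show ?thesis using lap_min_start[OF y] full[OF y] by (simp add: add_grain_def)
    next
      case 2
      have "lap ?z h \<le> 3"
        using lap_min_le[of h "d y"] lap_min_saturated[of "d y" h] lap_depth_hole by fastforce
      then show ?thesis using 2 y empty by (simp add: add_grain_def)
    next
      case 3
      have "lap ?z w \<le> 0"
        using lap_min_le[of w "d y"] lap_min_saturated[of "d y" w] depth_superharmonic[OF 3(1)] 3(3)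
        by fastforce
      then show ?thesis using 3 full by (simp add: add_grain_def)
    next
      case 4
      then have add: "add_grain y \<eta> w = \<eta> w" using y by (auto simp: add_grain_def)
      show ?thesis
      proof (cases "\<exists>p\<in>subsquare a b n 1. nbr w p")
        case True
        then have "\<eta> w \<le> 2" using border[OF w 4] by blast
        moreover have "lap ?z w \<le> 1"
          using lap_outside[OF 4 depth_nonneg, of a b n y] True by simp
        ultimately show ?thesis using add by linarith
      next
        case False
        then have "lap ?z w \<le> 0" using lap_outside[OF 4 depth_nonneg, of a b n y] by simp
        then show ?thesis using add range[OF w] by linarith
      qed
    qed
  qed
  ultimately show ?thesis
    unfolding stabilises_def using rdepth_nonneg depth_nonneg by simp
qed

text \<open>
  Induction over the waves. Let every vertex topple at least as often as in the first \<open>s - 1\<close> waves.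
  If \<open>y\<close> does not topple once more, it is left with at least four grains. If a critical vertex of
  depth at least \<open>s\<close> does not, although a neighbour does, it is left with four or more, too. So wave
  \<open>s\<close> spreads from \<open>y\<close> over the concentric square without the hole. If the hole is strictly inside,
  all its four neighbours are reached, and it has to topple as well.
\<close>

lemma avalanche_least:
  assumes y: "y \<in> subsquare a b n 1" "y \<noteq> h"
    and u: "stabilises L (add_grain y \<eta>) u"
  shows "min (rdepth w) (d y) \<le> u w"
proof -
  have stable: "add_grain y \<eta> w + lap u w \<le> 3" if "w \<in> subsquare a b n 1" for w
    using u that in_grid by (auto simp: stabilises_def)
  have "int t \<le> d y \<Longrightarrow> min (rdepth w) (int t) \<le> u w" for t w
  proof (induction t arbitrary: w)
    case 0
    have "0 \<le> u w" using u unfolding stabilises_def by blast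
    then show ?case by simp
  next
    case (Suc t)
    define s where "s = int (Suc t)"
    have s: "1 \<le> s" "s \<le> d y" using Suc.prems by (auto simp: s_def)
    have IH: "min (rdepth p) (s - 1) \<le> u p" for p using Suc by (simp add: s_def)
    let ?Q = "subsquare a b n s - {h}"
    have sub: "p \<in> subsquare a b n 1" if "s \<le> rdepth p" for p
    proof -
      have "s \<le> d p" using that rdepth_le[of p] by linarith
      then show ?thesis using s(1) depth_pos_iff[of p] by linarith
    qed
    have Q_d': "s \<le> rdepth p" if "p \<in> ?Q" for p
      using that depth_ge_iff[OF s(1), of a b n p] by (simp add: rdepth_def)
    \<comment> \<open>A counterexample \<open>p\<close> topples exactly \<open>s - 1\<close> times, and no neighbour topples less.\<close>
    have level: "u p = s - 1" "\<And>q. nbr p q \<Longrightarrow> s - 1 \<le> u q" if "s \<le> rdepth p" "u p < s" for p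
    proof -
      show "u p = s - 1" using IH[of p] that by linarith
      fix q assume "nbr p q"
      then show "s - 1 \<le> u q" using rdepth_nbr[of p q] IH[of q] that by linarith
    qed
    have no_drop: "0 \<le> lap u p" if "s \<le> rdepth p" "u p < s" for p
    proof -
      have "u p \<le> u q" if "nbr p q" for q
        using level[OF \<open>s \<le> rdepth p\<close> \<open>u p < s\<close>] that by simp
      then show ?thesis using lap_mono[of p "\<lambda>_. u p" u] by simp
    qed
    have start: "s \<le> u y"
    proof (rule ccontr)
      assume "\<not> s \<le> u y"
      moreover have "s \<le> rdepth y" using s y by (simp add: rdepth_def)
      ultimately show False
        using no_drop[of y] stable[OF y(1)] full[OF y] by (simp add: add_grain_def)
    qed
    have spread: "s \<le> u q" if p: "s \<le> u p" and q: "q \<in> ?Q" and pq: "nbr p q" for p q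
    proof (rule ccontr)
      assume "\<not> s \<le> u q"
      then have uq: "u q < s" by simp
      note lev = level[OF Q_d'[OF q] uq]
      have "nbr q p" using pq by (simp add: nbr_def abs_minus_commute)
      then have "1 \<le> lap u q"
        using lap_strict_mono[of q "\<lambda>_. s - 1" u p] lev p by simp
      moreover have "q \<in> subsquare a b n 1" "q \<noteq> h" using sub[OF Q_d'[OF q]] q by auto
      ultimately show False
        using stable[of q] full[of q] by (simp add: add_grain_def split: if_splits)
    qed
    have yQ: "y \<in> ?Q" using depth_ge_iff[OF s(1), of a b n y] s(2) y(2) by simp
    \<comment> \<open>The innermost square of odd side is a single point, which has to be \<open>y\<close>.\<close>
    have filled: "s \<le> u p" if "p \<in> ?Q" for p
    proof (cases "2 * s \<le> n")
      case True
      have "?Q \<subseteq> {p. s \<le> u p}"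
        unfolding subsquare_def
        by (rule rectangle_minus_point_spread[of _ _ _ _ y])
          (use True start yQ spread in \<open>auto simp: subsquare_def\<close>)
      then show ?thesis using that by blast
    next
      case False
      then have "p = y" using that yQ by (cases p; cases y) (auto simp: subsquare_def)
      then show ?thesis using start by simp
    qed
    have "s \<le> u w" if w: "s \<le> rdepth w"
    proof (cases "w = h")
      case False
      then show ?thesis using filled[of w] w depth_ge_iff[OF s(1), of a b n w] by (simp add: rdepth_def)
    next
      case True
      show ?thesis
      proof (rule ccontr)
        assume "\<not> s \<le> u w"
        then have "u h = s - 1" using level(1)[of h] w True by simp
        moreover have "s \<le> u q" if "nbr h q" for q
        proof (rule filled)
          have "s \<le> d q" using depth_nbr[of q h a b n] that w True
            by (auto simp: rdepth_def nbr_def abs_minus_commute)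
          moreover have "q \<noteq> h" using that by (auto simp: nbr_def)
          ultimately show "q \<in> ?Q" using depth_ge_iff[OF s(1), of a b n q] by simp
        qed
        ultimately have "4 \<le> lap u h" using lap_mono[of h "\<lambda>_. s" u] by simp
        then show False
          using stable[OF hole_in_square] empty y(2) by (simp add: add_grain_def)
      qed
    qed
    then have "min (rdepth w) s \<le> u w" using IH[of w] by linarith
    then show ?case unfolding s_def .
  qed
  from this[of "nat (d y)" w] show ?thesis using depth_nonneg[of a b n y] by simp
qed

theorem avalanche_size_holed_square:
  assumes "y \<in> subsquare a b n 1" "y \<noteq> h"
  shows "int (avalanche_size L \<eta> y) = (\<Sum>w\<in>subsquare a b n 1. min (rdepth w) (d y))"
proof -
  have "int (avalanche_size L \<eta> y) = (\<Sum>w\<in>grid L. min (rdepth w) (d y))"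
    using range by (intro avalanche_size_eq_least_stabiliser avalanche_stabilises avalanche_least assms) auto
  also have "\<dots> = (\<Sum>w\<in>subsquare a b n 1. min (rdepth w) (d y))"
  proof (rule sum.mono_neutral_right)
    show "\<forall>w\<in>grid L - subsquare a b n 1. min (rdepth w) (d y) = 0"
    proof
      fix w assume "w \<in> grid L - subsquare a b n 1"
      then have "d w = 0" "w \<noteq> h"
        using depth_pos_iff[of w] depth_nonneg[of a b n w] hole_in_square by auto
      then show "min (rdepth w) (d y) = 0" using depth_nonneg[of a b n y] by (simp add: rdepth_def)
    qed
  qed (use in_grid finite_grid in auto)
  finally show ?thesis .
qed

lemma avalanche_size_hole: "avalanche_size L \<eta> h = 0"
proof -
  have "h \<in> grid L" using hole_in_square in_grid by blast
  then have "stabilises L (add_grain h \<eta>) (\<lambda>_. 0)"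
    using range empty by (auto simp: stabilises_def add_grain_def lap_def)
  then have "int (avalanche_size L \<eta> h) = (\<Sum>w\<in>grid L. 0)"
    using range by (intro avalanche_size_eq_least_stabiliser) (auto simp: stabilises_def)
  then show ?thesis by simp
qed

text \<open>
  The three terms are: all pairs of a start and a toppling vertex as if there were no hole, the
  avalanches starting at the hole, and the one toppling that the hole loses in every avalanche which
  starts elsewhere in its concentric square.
\<close>

theorem sum_avalanche_size_holed_square:
  assumes M: "n \<le> 2 * M" "2 * M \<le> n + 1"
  shows "(\<Sum>y\<in>subsquare a b n 1. int (avalanche_size L \<eta> y)) =
    (\<Sum>t\<in>{1..M}. (n - 2 * t + 2) ^ 4) - (\<Sum>t\<in>{1..D}. (n - 2 * t + 2)\<^sup>2) - ((n - 2 * D + 2)\<^sup>2 - 1)"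
proof -
  let ?A = "subsquare a b n 1"
  have fin: "finite ?A" by (simp add: subsquare_def)
  have n: "0 \<le> n" using D by simp
  have dM: "d p \<le> M" for p using depth_le[OF n, of a b p] M by linarith
  have DM: "D \<le> M" using dM[of h] depth_hole by simp
  have level: "(\<Sum>w\<in>?A. of_bool (t \<le> d w)) = (n - 2 * t + 2)\<^sup>2" if "1 \<le> t" "t \<le> M" for t
    using that M by (intro sum_depth_ge) auto
  define F where "F c = (\<Sum>w\<in>?A. min (d w) c)" for c
  have F: "F c = (\<Sum>t\<in>{1..M}. of_bool (t \<le> c) * (n - 2 * t + 2)\<^sup>2)" if "0 \<le> c" "c \<le> M" for c
  proof -
    have "F c = (\<Sum>w\<in>?A. \<Sum>t\<in>{1..M}. of_bool (t \<le> d w) * of_bool (t \<le> c))"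
      unfolding F_def using that dM depth_nonneg by (intro sum.cong min_eq_sum_levels) auto
    also have "\<dots> = (\<Sum>t\<in>{1..M}. \<Sum>w\<in>?A. of_bool (t \<le> d w) * of_bool (t \<le> c))"
      by (rule sum.swap)
    also have "\<dots> = (\<Sum>t\<in>{1..M}. of_bool (t \<le> c) * (n - 2 * t + 2)\<^sup>2)"
      by (intro sum.cong) (simp_all add: sum_distrib_right[symmetric] level mult.commute)
    finally show ?thesis .
  qed
  have "(\<Sum>y\<in>?A. F (d y)) =
      (\<Sum>y\<in>?A. \<Sum>t\<in>{1..M}. of_bool (t \<le> d y) * (n - 2 * t + 2)\<^sup>2)"
    using F dM depth_nonneg by (intro sum.cong) auto
  also have "\<dots> = (\<Sum>t\<in>{1..M}. \<Sum>y\<in>?A. of_bool (t \<le> d y) * (n - 2 * t + 2)\<^sup>2)"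
    by (rule sum.swap)
  also have "\<dots> = (\<Sum>t\<in>{1..M}. (n - 2 * t + 2) ^ 4)"
    by (intro sum.cong) (simp_all add: sum_distrib_right[symmetric] level flip: power_add)
  finally have quartic: "(\<Sum>y\<in>?A. F (d y)) = (\<Sum>t\<in>{1..M}. (n - 2 * t + 2) ^ 4)" .
  have "{t \<in> {1..M}. t \<le> D} = {1..D}" using DM by auto
  then have quadratic: "F D = (\<Sum>t\<in>{1..D}. (n - 2 * t + 2)\<^sup>2)"
    using F[of D] D DM sum.inter_filter[of "{1..M}" "\<lambda>t. (n - 2 * t + 2)\<^sup>2" "\<lambda>t. t \<le> D"]
    by (simp add: of_bool_def if_distrib[of "\<lambda>x. x * _"] cong: if_cong)
  \<comment> \<open>The hole falls short of its depth exactly when \<open>y\<close> lies in its concentric square.\<close>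
  have size: "int (avalanche_size L \<eta> y) = F (d y) - of_bool (D \<le> d y)" if "y \<in> ?A - {h}" for y
  proof -
    have "min (rdepth w) (d y) = min (d w) (d y) - of_bool (w = h \<and> D \<le> d y)" for w
      using depth_hole by (auto simp: rdepth_def)
    then have "int (avalanche_size L \<eta> y) = F (d y) - (\<Sum>w\<in>?A. of_bool (w = h \<and> D \<le> d y))"
      using avalanche_size_holed_square[of y] that by (simp add: F_def sum_subtractf)
    also have "(\<Sum>w\<in>?A. of_bool (w = h \<and> D \<le> d y)) = (of_bool (D \<le> d y) :: int)"
      using fin hole_in_square by (cases "D \<le> d y") (simp_all add: of_bool_def)
    finally show ?thesis .
  qed
  have "(\<Sum>y\<in>?A. int (avalanche_size L \<eta> y)) = (\<Sum>y\<in>?A - {h}. F (d y) - of_bool (D \<le> d y))"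
    using sum.remove[OF fin hole_in_square, of "\<lambda>y. int (avalanche_size L \<eta> y)"] size
      avalanche_size_hole by simp
  also have "\<dots> = (\<Sum>y\<in>?A. F (d y) - of_bool (D \<le> d y)) - (F D - 1)"
    using sum.remove[OF fin hole_in_square, of "\<lambda>y. F (d y) - of_bool (D \<le> d y)"] depth_hole by simp
  also have "\<dots> = (\<Sum>y\<in>?A. F (d y)) - (n - 2 * D + 2)\<^sup>2 - (F D - 1)"
    using level[of D] D DM by (simp add: sum_subtractf)
  finally show ?thesis unfolding quartic quadratic by simp
qed

end

section \<open>Rings and generators\<close>

lemma num_rings_eq: "num_rings N = (N + 1) div 2"
proof (cases "even N")
  case True
  then show ?thesis by (auto elim!: evenE simp: num_rings_def)
next
  case False
  then obtain c where c: "N = 2 * c + 1" by (auto elim: oddE)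
  have "\<lceil>real N / 2\<rceil> = int c + 1" by (rule ceiling_unique) (simp_all add: c field_simps)
  then show ?thesis by (simp add: num_rings_def c)
qed

lemma card_outer_nbrs:
  "card {w. nbr (x, y) w \<and> w \<notin> B} =
     of_bool ((x + 1, y) \<notin> B) + of_bool ((x - 1, y) \<notin> B)
     + of_bool ((x, y + 1) \<notin> B) + of_bool ((x, y - 1) \<notin> B)"
proof -
  let ?U = "{(x + 1, y), (x - 1, y), (x, y + 1), (x, y - 1)}"
  have "{w. nbr (x, y) w \<and> w \<notin> B} = {w \<in> ?U. w \<notin> B}"
    unfolding nbr_iff by simp
  then have "card {w. nbr (x, y) w \<and> w \<notin> B} = (\<Sum>w | w \<in> ?U \<and> w \<notin> B. 1)"
    by (simp only: card_eq_sum)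
  also have "\<dots> = (\<Sum>w\<in>?U. of_bool (w \<notin> B))"
    unfolding of_bool_def by (rule sum.inter_filter) simp
  finally show ?thesis by simp
qed

lemma card_outer_nbrs_subsquare:
  assumes "(x, y) \<in> subsquare a b n t"
  shows "card {w. nbr (x, y) w \<and> w \<notin> subsquare a b n t} =
     of_bool (x = a + n - t) + of_bool (x = a + t - 1)
     + of_bool (y = b + n - t) + of_bool (y = b + t - 1)"
proof -
  have "(x + 1, y) \<notin> subsquare a b n t \<longleftrightarrow> x = a + n - t"
    "(x - 1, y) \<notin> subsquare a b n t \<longleftrightarrow> x = a + t - 1"
    "(x, y + 1) \<notin> subsquare a b n t \<longleftrightarrow> y = b + n - t"
    "(x, y - 1) \<notin> subsquare a b n t \<longleftrightarrow> y = b + t - 1"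
    using assms by (auto simp: subsquare_def)
  then show ?thesis unfolding card_outer_nbrs by simp
qed

lemma corners_subsquare:
  assumes "2 * t + 1 \<le> n"
  shows "corners (subsquare a b n t) = {a + t - 1, a + n - t} \<times> {b + t - 1, b + n - t}"
proof -
  have "(x, y) \<in> corners (subsquare a b n t) \<longleftrightarrow>
      (x, y) \<in> {a + t - 1, a + n - t} \<times> {b + t - 1, b + n - t}" for x y
  proof (cases "(x, y) \<in> subsquare a b n t")
    case True
    then show ?thesis
      using assms unfolding corners_def mem_Collect_eq card_outer_nbrs_subsquare[OF True]
      by (auto simp: of_bool_def split: if_splits)
  next
    case False
    then show ?thesis using assms by (auto simp: corners_def subsquare_def)
  qed
  then show ?thesis by auto
qed

lemma outer_layer_subsquare:
  assumes "2 * t + 1 \<le> n"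
  shows "inner_boundary (subsquare a b n t) \<union> corners (subsquare a b n t) =
    subsquare a b n t - subsquare a b n (t + 1)"
proof -
  have "(x, y) \<in> inner_boundary (subsquare a b n t) \<union> corners (subsquare a b n t) \<longleftrightarrow>
      (x, y) \<in> subsquare a b n t - subsquare a b n (t + 1)" for x y
  proof (cases "(x, y) \<in> subsquare a b n t")
    case True
    have "(x, y) \<notin> subsquare a b n (t + 1) \<longleftrightarrow>
        x = a + n - t \<or> x = a + t - 1 \<or> y = b + n - t \<or> y = b + t - 1"
      using True by (auto simp: subsquare_def)
    then show ?thesis
      using assms True
      unfolding inner_boundary_def corners_def Un_iff mem_Collect_eq card_outer_nbrs_subsquare[OF True]
      by (auto simp: of_bool_def split: if_splits)
  next
    case False
    then show ?thesis by (auto simp: inner_boundary_def corners_def)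
  qed
  then show ?thesis by auto
qed

text \<open>
  Rings are numbered from the centre, depths from the border: the \<open>j\<close>-th ring of \<open>m\<close> has depth
  \<open>m + 1 - j\<close>. For \<open>j \<ge> 2\<close> the square that remains after peeling has side at least three, so its
  outermost layer consists of the vertices with one or two outer neighbours.
\<close>

lemma ring_layer_eq:
  assumes "1 \<le> j" "j \<le> num_rings N"
  shows "ring_layer N (subsquare a b (int N) 1) j =
    {p. depth a b (int N) p = int (num_rings N + 1 - j)}"
  using assms
proof (induction "num_rings N - j" arbitrary: j rule: less_induct)
  case less
  let ?A = "subsquare a b (int N) 1" and ?d = "depth a b (int N)" and ?m = "num_rings N"
  define t where "t = int (?m + 1 - j)"
  have t: "1 \<le> t" using less.prems by (simp add: t_def)
  have m: "2 * ?m \<le> N + 1" by (simp add: num_rings_eq)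
  have outer: "ring_layer N ?A k = {p. ?d p = int (?m + 1 - k)}" if "k \<in> {j + 1..?m}" for k
    using that less.prems by (intro less.hyps) auto
  have "(\<Union>k\<in>{j + 1..?m}. ring_layer N ?A k) = {p. 1 \<le> ?d p \<and> ?d p < t}"
  proof (intro equalityI subsetI)
    fix p assume "p \<in> {p. 1 \<le> ?d p \<and> ?d p < t}"
    then have "?m + 1 - nat (?d p) \<in> {j + 1..?m}" "?d p = int (?m + 1 - (?m + 1 - nat (?d p)))"
      by (auto simp: t_def)
    then show "p \<in> (\<Union>k\<in>{j + 1..?m}. ring_layer N ?A k)" using outer by blast
  qed (use outer in \<open>auto simp: t_def\<close>)
  moreover have "?A = {p. 1 \<le> ?d p}" using depth_ge_iff[of 1] by auto
  ultimately have "?A - (\<Union>k\<in>{j + 1..?m}. ring_layer N ?A k) = {p. t \<le> ?d p}"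
    using t by auto
  also have B: "{p. t \<le> ?d p} = subsquare a b (int N) t" using depth_ge_iff[OF t] by auto
  finally have "ring_layer N ?A j = (if j = 1 then subsquare a b (int N) t
      else inner_boundary (subsquare a b (int N) t) \<union> corners (subsquare a b (int N) t))"
    by (subst ring_layer.simps) (simp add: Let_def)
  also have "\<dots> = {p. ?d p = t}"
  proof (cases "j = 1")
    case True
    have "?d p \<le> t" for p
      using depth_le[of "int N" a b p] True by (simp add: t_def num_rings_eq)
    then have "{p. ?d p = t} = {p. t \<le> ?d p}" by (auto intro: antisym)
    then show ?thesis using True B by simp
  next
    case False
    then have "2 * t + 1 \<le> int N" using less.prems m by (simp add: t_def)
    then have "inner_boundary (subsquare a b (int N) t) \<union> corners (subsquare a b (int N) t) =
        {p. t \<le> ?d p} - {p. t + 1 \<le> ?d p}"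
      using t by (simp add: outer_layer_subsquare depth_ge_iff)
    also have "\<dots> = {p. ?d p = t}" by (intro set_eqI) (simp; linarith)
    finally show ?thesis using False by simp
  qed
  finally show ?case by (simp add: t_def)
qed

lemma Union_ring_layer_eq:
  assumes "1 \<le> k" "k \<le> num_rings N"
  shows "(\<Union>j\<in>{1..k}. ring_layer N (subsquare a b (int N) 1) j) =
    subsquare a b (int N) (int (num_rings N + 1 - k))"
proof -
  let ?d = "depth a b (int N)" and ?m = "num_rings N"
  have "(\<Union>j\<in>{1..k}. ring_layer N (subsquare a b (int N) 1) j) =
      (\<Union>j\<in>{1..k}. {p. ?d p = int (?m + 1 - j)})"
    using assms by (simp add: ring_layer_eq)
  also have "\<dots> = {p. int (?m + 1 - k) \<le> ?d p}"
  proof (intro equalityI subsetI)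
    fix p assume p: "p \<in> {p. int (?m + 1 - k) \<le> ?d p}"
    have "?d p \<le> int ?m" using depth_le[of "int N" a b p] by (simp add: num_rings_eq)
    then have "?m + 1 - nat (?d p) \<in> {1..k}" "?d p = int (?m + 1 - (?m + 1 - nat (?d p)))"
      using p assms by auto
    then show "p \<in> (\<Union>j\<in>{1..k}. {p. ?d p = int (?m + 1 - j)})" by blast
  qed auto
  also have "\<dots> = subsquare a b (int N) (int (?m + 1 - k))"
    using assms depth_ge_iff[of "int (?m + 1 - k)" a b "int N"] by auto
  finally show ?thesis .
qed

lemma lattice_connected_insert:
  assumes "lattice_connected A" "p \<in> A" "nbr w p"
  shows "lattice_connected (insert w A)"
proof -
  let ?R = "\<lambda>S. {(u, v). u \<in> S \<and> v \<in> S \<and> nbr u v}"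
  have "(?R A)\<^sup>* \<subseteq> (?R (insert w A))\<^sup>*" by (rule rtrancl_mono) auto
  then have A: "(u, v) \<in> (?R (insert w A))\<^sup>*" if "u \<in> A" "v \<in> A" for u v
    using assms(1) that unfolding lattice_connected_def by blast
  have "(w, p) \<in> (?R (insert w A))\<^sup>*" "(p, w) \<in> (?R (insert w A))\<^sup>*"
    using assms(2,3) by (auto simp: nbr_def abs_minus_commute)
  then have "(u, p) \<in> (?R (insert w A))\<^sup>* \<and> (p, u) \<in> (?R (insert w A))\<^sup>*" if "u \<in> insert w A" for u
    using that A[OF _ assms(2)] A[OF assms(2)] by blast
  then show ?thesis unfolding lattice_connected_def by (meson rtrancl_trans)
qed

text \<open>
  A critical neighbour could be added to the generator without losing connectedness.
\<close>

lemma generator_border: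
  assumes "generator L \<eta> A" "w \<in> grid L" "w \<notin> A" "p \<in> A" "nbr w p"
  shows "\<eta> w \<noteq> 3"
proof
  assume "\<eta> w = 3"
  then have "insert w A \<subseteq> critical L \<eta>"
    using assms(1,2) by (auto simp: generator_def critical_def)
  moreover have "lattice_connected (insert w A)"
    using assms(1,4,5) by (intro lattice_connected_insert) (auto simp: generator_def)
  ultimately have "insert w A = A" using assms(1) unfolding generator_def by blast
  then show False using assms(3) by blast
qed

section \<open>The expected avalanche size\<close>

theorem lemma4p5:
  fixes L N k :: nat and \<eta> :: sandpile and A :: "vertex set" and v :: vertex
  assumes "L \<ge> 1"
    and "\<eta> \<in> stable_sandpiles L"
    and "N \<ge> 3"
    and "generator L \<eta> A"
    and "is_square N A"
    and "k \<in> {2..num_rings N}"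
    and "v \<in> corners (\<Union>j\<in>{1..k}. ring_layer N A j)"
  shows "cond_avalanche L (removal v \<eta>) A =
    (if odd N then
       (3 * real N ^ 5 + 15 * real N ^ 4 + 15 * real N ^ 3 - 15 * real N ^ 2 - 18 * real N
         + 10 * (4 * real k ^ 3 - 24 * real k ^ 2 + 23 * real k - 3)) / (30 * real N ^ 2)
     else
       (3 * real N ^ 5 + 15 * real N ^ 4 + 15 * real N ^ 3 - 15 * real N ^ 2 - 18 * real N
         + 10 * (4 * real k ^ 3 - 18 * real k ^ 2 + 2 * real k + 3)) / (30 * real N ^ 2))"
proof -
  obtain a b where "A = {a..<a + int N} \<times> {b..<b + int N}"
    using assms(5) by (auto simp: is_square_def)
  then have A: "A = subsquare a b (int N) 1" by (auto simp: subsquare_def)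
  define M where "M = int (num_rings N)"
  define D where "D = M + 1 - int k"
  have M: "int N \<le> 2 * M" "2 * M \<le> int N + 1" by (simp_all add: M_def num_rings_eq)
  have k: "2 \<le> k" "int k \<le> M" using assms(6) by (auto simp: M_def)
  have D: "1 \<le> D" "2 * D + 1 \<le> int N" using k M by (auto simp: D_def)
  have "D = int (num_rings N + 1 - k)" using k by (simp add: D_def M_def)
  then have "(\<Union>j\<in>{1..k}. ring_layer N A j) = subsquare a b (int N) D"
    using Union_ring_layer_eq[of k N a b] assms(6) by (simp only: A) simp
  then have corner: "v \<in> {a + D - 1, a + int N - D} \<times> {b + D - 1, b + int N - D}"
    using assms(7) corners_subsquare[OF D(2), of a b] by (simp only:)
  have crit: "A \<subseteq> grid L" "w \<in> A \<Longrightarrow> \<eta> w = 3" for w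
    using assms(4) by (auto simp: generator_def critical_def)
  interpret holed_square L "removal v \<eta>" a b "int N" D v
  proof
    show "0 \<le> removal v \<eta> w \<and> removal v \<eta> w \<le> 3" if "w \<in> grid L" for w
      using assms(2) that by (auto simp: removal_def stable_sandpiles_def)
    show "removal v \<eta> w \<le> 2"
      if "w \<in> grid L" "w \<notin> subsquare a b (int N) 1" "p \<in> subsquare a b (int N) 1" "nbr w p" for w p
      using assms(2) that generator_border[OF assms(4) that(1), of p]
      by (force simp: A removal_def stable_sandpiles_def)
  qed (use crit corner D in \<open>auto simp: A removal_def\<close>)
  define T where "T = (\<Sum>y\<in>A. int (avalanche_size L (removal v \<eta>) y))"
  have T: "30 * T = 3 * int N ^ 5 + 15 * int N ^ 4 + 20 * int N ^ 3 - 8 * int N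
      - 5 * ((int N) ^ 3 + 3 * (int N)\<^sup>2 + 2 * int N)
      + 5 * ((int N - 2 * D) ^ 3 + 3 * (int N - 2 * D)\<^sup>2 + 2 * (int N - 2 * D))
      - 30 * ((int N - 2 * D + 2)\<^sup>2 - 1)"
  proof -
    \<comment> \<open>The side that would follow the innermost one; the quartic antiderivative vanishes there.\<close>
    have "int N - 2 * M = 0 \<or> int N - 2 * M = - 1" using M by linarith
    then have "30 * (\<Sum>t\<in>{1..M}. (int N - 2 * t + 2) ^ 4) =
        3 * int N ^ 5 + 15 * int N ^ 4 + 20 * int N ^ 3 - 8 * int N"
      using sum_fourth_powers_step2[of M "int N"] k by auto
    then show ?thesis
      using sum_squares_step2[of D "int N"] D
      unfolding T_def A sum_avalanche_size_holed_square[OF M] by simp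
  qed
  have card: "card A = N ^ 2"
    by (simp add: A subsquare_def power2_eq_square)
  have "A \<noteq> {}" using assms(4) by (simp add: generator_def)
  then have "cond_avalanche L (removal v \<eta>) A = real_of_int T / real N ^ 2"
    using crit(1) by (simp add: cond_avalanche_eq_average card T_def)
  also have "\<dots> = real_of_int (30 * T) / (30 * real N ^ 2)" by simp
  finally have avg: "cond_avalanche L (removal v \<eta>) A = real_of_int (30 * T) / (30 * real N ^ 2)" .
  show ?thesis
  proof (cases "odd N")
    case True
    then have ND: "int N - 2 * D = 2 * int k - 3" using M by (simp add: D_def) presburger
    have "30 * T = 3 * int N ^ 5 + 15 * int N ^ 4 + 15 * int N ^ 3 - 15 * int N ^ 2 - 18 * int N
        + 10 * (4 * int k ^ 3 - 24 * int k ^ 2 + 23 * int k - 3)"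
      unfolding T ND by (simp add: algebra_simps power2_eq_square power3_eq_cube)
    then show ?thesis unfolding avg using True by simp
  next
    case False
    then have ND: "int N - 2 * D = 2 * int k - 2" using M by (simp add: D_def) presburger
    have "30 * T = 3 * int N ^ 5 + 15 * int N ^ 4 + 15 * int N ^ 3 - 15 * int N ^ 2 - 18 * int N
        + 10 * (4 * int k ^ 3 - 18 * int k ^ 2 + 2 * int k + 3)"
      unfolding T ND by (simp add: algebra_simps power2_eq_square power3_eq_cube)
    then show ?thesis unfolding avg using False by simp
  qed
qed

end
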